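(* Let $l_1, l_2 \in \mathbb{R}_+$ and $\alpha \in (0, \pi/2]$ be such that the flat torus $T_{l_1,l_2,\alpha}$ is perfectly periodic, and let $n, m \in \mathbb{N}$ be such that $2r < 1$, where $r = \frac{c}{2\sin\alpha}$, $c = \sqrt{a^2+b^2-2ab\cos\alpha}$, $a = l_1/n$, $b = l_2/m$. Let $G_{n,m} = (V_{n,m}, E_{n,m})$ be the undirected graph on $T_{l_1,l_2,\alpha}$ defined in the context. If $M \subset V_{n,m}$ is an independent set of $G_{n,m}$, then $$m_1(\mathbb{R}^2) \ge \frac{|M|}{n\cdot m}.$$
   Context: Density. A set $A \subset \mathbb{R}^2$ is 1-avoiding if no two of its points are at Euclidean distance exactly $1$. For measurable $A\subset\mathbb{R}^2$, the upper density is $\overline{\delta(A)} = \limsup_{R\to\infty} \frac{\lambda_2(A\cap B_2(x,R))}{\lambda_2(B_2(x,R))}$, where $\lambda_2$ is 2-dimensional Lebesgue measure and $B_2(x,R)$ is the disc of radius $R$ centered at a fixed $x \in \mathbb{R}^2$ (the value does not depend on $x$). $m_1(\mathbb{R}^2)$ is the supremum of $\overline{\delta(A)}$ over all 1-avoiding measurable sets $A\subset\mathbb{R}^2$. Flat torus. For $l_1,l_2\in\mathbb{R}_+$ (positive reals) and $\alpha\in(0,\pi/2]$, let $\vec v_1,\vec v_2\in\mathbb{R}^2$ be vectors with $|\vec v_1|=l_1$, $|\vec v_2|=l_2$ and angle $\alpha$ between them. The flat torus $T_{l_1,l_2,\alpha}$ is the parallelogram $\{x\vec v_1+y\vec v_2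 : x,y\in[0,1)\}$; the point $x\vec v_1+y\vec v_2$ is also written $(x,y)$. It carries the metric $$\rho\big((x_1,y_1),(x_2,y_2)\big)=\min\{|(x_2-x_1+k_1)\vec v_1+(y_2-y_1+k_2)\vec v_2| : k_1,k_2\in\mathbb{Z}\}.$$ $T_{l_1,l_2,\alpha}$ is called perfectly periodic if for any two points $p_1=(x_1,y_1)$, $p_2=(x_2,y_2)$ of it, $\rho(p_1,p_2)\ne 1$ implies $|(x_2-x_1+k_1)\vec v_1+(y_2-y_1+k_2)\vec v_2|\ne 1$ for all $k_1,k_2\in\mathbb{Z}$. Graph. For positive integers $n,m$, with $r$ as in the claim ($r$ is the circumradius of a triangle with sides $l_1/n$ and $l_2/m$ and angle $\alpha$ between them), $$V_{n,m}=\left\{\tfrac{i}{n}\vec v_1+\tfrac{j}{m}\vec v_2 : i\in\{0,\dots,n-1\},\ j\in\{0,\dots,m-1\}\right\},$$ $$E_{n,m}=\{(v_1,v_2)\in V_{n,m}\times V_{n,m} : \rho(v_1,v_2)\in[1-2r,1+2r]\}.$$ $G_{n,m}=(V_{n,m},E_{n,m})$ is regarded as an undirected graph. An independent set is a set of vertices no two distinct elements of which are joined by an edge. *)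

theory Defs
  imports "HOL-Analysis.Analysis"
begin

definition one_avoiding :: "(real ^ 2) set \<Rightarrow> bool" where
  "one_avoiding A \<longleftrightarrow> (\<forall>p\<in>A. \<forall>q\<in>A. dist p q \<noteq> 1)"

definition upper_density :: "real ^ 2 \<Rightarrow> (real ^ 2) set \<Rightarrow> ereal" where
  "upper_density x A =
     Limsup at_top (\<lambda>R::real. ereal (measure lebesgue (A \<inter> ball x R) / measure lebesgue (ball x R)))"

(* The upper density does not depend on the centre of the discs; the origin is used. *)
definition m1_plane :: ereal where
  "m1_plane = (SUP A \<in> {A. A \<in> sets lebesgue \<and> one_avoiding A}. upper_density 0 A)"

definition vec_angle :: "real ^ 2 \<Rightarrow> real ^ 2 \<Rightarrow> real" where
  "vec_angle v w = arccos (v \<bullet> w / (norm v * norm w))"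

definition flat_torus :: "real ^ 2 \<Rightarrow> real ^ 2 \<Rightarrow> (real ^ 2) set" where
  "flat_torus v1 v2 = {x *\<^sub>R v1 + y *\<^sub>R v2 | x y. x \<in> {0..<1} \<and> y \<in> {0..<1}}"

(* For p = x1 v1 + y1 v2 and q = x2 v1 + y2 v2 this is
   (x2 - x1 + k1) v1 + (y2 - y1 + k2) v2. *)
definition lattice_diff ::
    "real ^ 2 \<Rightarrow> real ^ 2 \<Rightarrow> real ^ 2 \<Rightarrow> real ^ 2 \<Rightarrow> int \<Rightarrow> int \<Rightarrow> real ^ 2" where
  "lattice_diff v1 v2 p q k1 k2 = q - p + of_int k1 *\<^sub>R v1 + of_int k2 *\<^sub>R v2"

(* When v1, v2 are linearly independent, they span a discrete lattice and the
   infimum is a minimum. *)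
definition torus_dist :: "real ^ 2 \<Rightarrow> real ^ 2 \<Rightarrow> real ^ 2 \<Rightarrow> real ^ 2 \<Rightarrow> real" where
  "torus_dist v1 v2 p q = Inf {norm (lattice_diff v1 v2 p q k1 k2) | k1 k2. True}"

definition perfectly_periodic :: "real ^ 2 \<Rightarrow> real ^ 2 \<Rightarrow> bool" where
  "perfectly_periodic v1 v2 \<longleftrightarrow>
     (\<forall>p \<in> flat_torus v1 v2. \<forall>q \<in> flat_torus v1 v2.
        torus_dist v1 v2 p q \<noteq> 1 \<longrightarrow> (\<forall>k1 k2. norm (lattice_diff v1 v2 p q k1 k2) \<noteq> 1))"

definition grid_vertices :: "real ^ 2 \<Rightarrow> real ^ 2 \<Rightarrow> nat \<Rightarrow> nat \<Rightarrow> (real ^ 2) set" where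
  "grid_vertices v1 v2 n m =
     {(real i / real n) *\<^sub>R v1 + (real j / real m) *\<^sub>R v2 | i j. i < n \<and> j < m}"

definition grid_edges ::
    "real ^ 2 \<Rightarrow> real ^ 2 \<Rightarrow> real \<Rightarrow> nat \<Rightarrow> nat \<Rightarrow> ((real ^ 2) \<times> (real ^ 2)) set" where
  "grid_edges v1 v2 r n m =
     {(p, q) \<in> grid_vertices v1 v2 n m \<times> grid_vertices v1 v2 n m.
        torus_dist v1 v2 p q \<in> {1 - 2 * r..1 + 2 * r}}"

(* The edge {u, w} is present when either orientation of the pair lies in E; the
   quantification over u and w covers both orientations. *)
definition independent_set :: "'a set \<Rightarrow> ('a \<times> 'a) set \<Rightarrow> 'a set \<Rightarrow> bool" where
  "independent_set V E M \<longleftrightarrow>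
     M \<subseteq> V \<and> (\<forall>u\<in>M. \<forall>w\<in>M. u \<noteq> w \<longrightarrow> (u, w) \<notin> E)"

end

theory Submission
  imports Defs
begin

text \<open>
Let \<open>\<Lambda>\<close> be the period lattice spanned by \<open>v1\<close> and \<open>v2\<close>, and let \<open>A\<close> be the union of all closed discs
of radius \<open>r\<close> around the points of \<open>M + \<Lambda>\<close>. This set is 1-avoiding and has upper density at least
\<open>|M| / (n m)\<close>.

For the first claim, the torus distance of two points is the distance of their difference to \<open>\<Lambda>\<close>, so
it is \<open>\<Lambda>\<close>-periodic, and moving each of the two points by at most \<open>r\<close> changes it by at most \<open>2 r\<close>. If
\<open>p, q \<in> A\<close> were at distance 1, perfect periodicity would make their torus distance equal to 1
(\<open>torus_dist_eq_1\<close>), hence the vertices \<open>x, y \<in> M\<close> whose discs contain them would have torus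
distance in \<open>[1 - 2 r, 1 + 2 r]\<close>. For \<open>x \<noteq> y\<close> this is an edge inside an independent set, and for
\<open>x = y\<close> it contradicts \<open>2 r < 1\<close> (\<open>one_avoiding_periodic_thickening\<close>).

The second claim follows by averaging the indicator function of \<open>A\<close> over the translates of \<open>A\<close> by the
\<open>n m\<close> grid points (\<open>upper_density_ge_by_averaging\<close>). Every point of the plane lies
within \<open>r\<close> of the fine lattice spanned by \<open>v1 / n\<close> and \<open>v2 / m\<close>, because a point of a triangle is never
further from all three vertices than the circumradius (\<open>lattice_covering_radius\<close>). If \<open>z\<close> is a fine
lattice point near \<open>p\<close>, then \<open>p - g\<close> is near \<open>z - g\<close>, and as \<open>g\<close> runs through the grid, \<open>z - g\<close> runs through
all classes of the fine lattice modulo \<open>\<Lambda>\<close>, of which \<open>|M|\<close> lie in \<open>M + \<Lambda>\<close>. So \<open>p\<close> is covered by at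
least \<open>|M|\<close> of the \<open>n m\<close> translates (\<open>card_translates_ge\<close>).
\<close>

section \<open>Lattice periodicity\<close>

definition integer_lattice :: "real ^ 2 \<Rightarrow> real ^ 2 \<Rightarrow> (real ^ 2) set" where
  "integer_lattice v1 v2 = range (\<lambda>(k1, k2). of_int k1 *\<^sub>R v1 + of_int k2 *\<^sub>R v2)"

lemma lattice_iff:
  "x \<in> integer_lattice v1 v2 \<longleftrightarrow> (\<exists>k1 k2. x = of_int k1 *\<^sub>R v1 + of_int k2 *\<^sub>R v2)"
  by (auto simp: integer_lattice_def)

lemma latticeI: "of_int k1 *\<^sub>R v1 + of_int k2 *\<^sub>R v2 \<in> integer_lattice v1 v2"
  by (auto simp: lattice_iff)

lemma countable_lattice: "countable (integer_lattice v1 v2)"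
  by (simp add: integer_lattice_def)

lemma zero_in_lattice: "0 \<in> integer_lattice v1 v2"
  using latticeI[of 0 v1 0 v2] by simp

lemma lattice_add:
  assumes "x \<in> integer_lattice v1 v2" "y \<in> integer_lattice v1 v2"
  shows "x + y \<in> integer_lattice v1 v2"
proof -
  obtain i j k l where "x = of_int i *\<^sub>R v1 + of_int j *\<^sub>R v2" "y = of_int k *\<^sub>R v1 + of_int l *\<^sub>R v2"
    using assms by (auto simp: lattice_iff)
  then have "x + y = of_int (i + k) *\<^sub>R v1 + of_int (j + l) *\<^sub>R v2"
    by (simp add: algebra_simps)
  then show ?thesis by (simp only: latticeI)
qed

lemma lattice_uminus:
  assumes "x \<in> integer_lattice v1 v2"
  shows "- x \<in> integer_lattice v1 v2"
proof -
  obtain i j where "x = of_int i *\<^sub>R v1 + of_int j *\<^sub>R v2"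
    using assms by (auto simp: lattice_iff)
  then have "- x = of_int (- i) *\<^sub>R v1 + of_int (- j) *\<^sub>R v2"
    by simp
  then show ?thesis by (simp only: latticeI)
qed

lemma lattice_diff_closed:
  "x \<in> integer_lattice v1 v2 \<Longrightarrow> y \<in> integer_lattice v1 v2 \<Longrightarrow> x - y \<in> integer_lattice v1 v2"
  using lattice_add[of x v1 v2 "- y"] lattice_uminus[of y] by simp

text \<open>
The lattice is symmetric, so minimising over all lifts of \<open>q - p\<close> is measuring the distance from \<open>p - q\<close>
to the lattice. In this form the 1-Lipschitz property of the torus distance is the triangle inequality
for \<^const>\<open>infdist\<close>.
\<close>

lemma torus_dist_eq_infdist:
  "torus_dist v1 v2 p q = infdist (p - q) (integer_lattice v1 v2)"
proof -
  have *: "norm (lattice_diff v1 v2 p q k1 k2) = dist (p - q) (of_int k1 *\<^sub>R v1 + of_int k2 *\<^sub>R v2)"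
    for k1 k2
    unfolding lattice_diff_def dist_norm by (subst norm_minus_commute) (simp add: algebra_simps)
  have "{norm (lattice_diff v1 v2 p q k1 k2) | k1 k2. True} = dist (p - q) ` integer_lattice v1 v2"
    by (fastforce simp: * lattice_iff image_iff)
  moreover have "integer_lattice v1 v2 \<noteq> {}"
    using zero_in_lattice by blast
  ultimately show ?thesis
    by (simp add: torus_dist_def infdist_def)
qed

lemma infdist_lattice_shift:
  assumes "l \<in> integer_lattice v1 v2"
  shows "infdist (x + l) (integer_lattice v1 v2) = infdist x (integer_lattice v1 v2)"
proof -
  have "dist (x + l) ` integer_lattice v1 v2 = dist x ` integer_lattice v1 v2" (is "?L = ?R")
  proof
    show "?L \<subseteq> ?R"
    proof clarify
      fix y assume "y \<in> integer_lattice v1 v2"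
      then have "y - l \<in> integer_lattice v1 v2" using assms lattice_diff_closed by blast
      moreover have "dist (x + l) y = dist x (y - l)" by (simp add: dist_norm algebra_simps)
      ultimately show "dist (x + l) y \<in> ?R" by blast
    qed
    show "?R \<subseteq> ?L"
    proof clarify
      fix y assume "y \<in> integer_lattice v1 v2"
      then have "y + l \<in> integer_lattice v1 v2" using assms lattice_add by blast
      moreover have "dist x y = dist (x + l) (y + l)" by simp
      ultimately show "dist x y \<in> ?L" by blast
    qed
  qed
  then show ?thesis
    using zero_in_lattice by (auto simp: infdist_def)
qed

lemma flat_torus_representative:
  assumes "p \<in> range (\<lambda>(s, t). s *\<^sub>R v1 + t *\<^sub>R v2)"
  obtains p0 where "p0 \<in> flat_torus v1 v2" "p - p0 \<in> integer_lattice v1 v2"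
proof -
  obtain s t where p: "p = s *\<^sub>R v1 + t *\<^sub>R v2" using assms by auto
  show thesis
  proof
    show "frac s *\<^sub>R v1 + frac t *\<^sub>R v2 \<in> flat_torus v1 v2"
      unfolding flat_torus_def using frac_ge_0 frac_lt_1 by fastforce
    have "p - (frac s *\<^sub>R v1 + frac t *\<^sub>R v2) = of_int \<lfloor>s\<rfloor> *\<^sub>R v1 + of_int \<lfloor>t\<rfloor> *\<^sub>R v2"
      by (simp add: p frac_def algebra_simps)
    then show "p - (frac s *\<^sub>R v1 + frac t *\<^sub>R v2) \<in> integer_lattice v1 v2"
      by (simp only: latticeI)
  qed
qed

section \<open>Avoiding distance one\<close>

definition periodic_thickening ::
    "real ^ 2 \<Rightarrow> real ^ 2 \<Rightarrow> real \<Rightarrow> (real ^ 2) set \<Rightarrow> (real ^ 2) set" where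
  "periodic_thickening v1 v2 r M = (\<Union>x\<in>M. \<Union>l\<in>integer_lattice v1 v2. cball (x + l) r)"

lemma sets_periodic_thickening:
  assumes "countable M"
  shows "periodic_thickening v1 v2 r M \<in> sets lebesgue"
  unfolding periodic_thickening_def
  by (intro sets.countable_UN'' assms countable_lattice) auto

text \<open>
This is perfect periodicity read contrapositively, and moved from the fundamental parallelogram to
arbitrary points: reducing \<open>p\<close> and \<open>q\<close> modulo the lattice turns \<open>q - p\<close> into one of the lifted differences
that the definition speaks of.
\<close>

lemma torus_dist_eq_1:
  assumes span: "range (\<lambda>(s, t). s *\<^sub>R v1 + t *\<^sub>R v2) = UNIV"
    and per: "perfectly_periodic v1 v2" and "dist p q = 1"
  shows "infdist (p - q) (integer_lattice v1 v2) = 1"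
proof -
  let ?L = "integer_lattice v1 v2"
  obtain p0 where p0: "p0 \<in> flat_torus v1 v2" "p - p0 \<in> ?L"
    using flat_torus_representative span by (metis UNIV_I)
  obtain q0 where q0: "q0 \<in> flat_torus v1 v2" "q - q0 \<in> ?L"
    using flat_torus_representative span by (metis UNIV_I)
  have d: "(q - q0) - (p - p0) \<in> ?L"
    using lattice_diff_closed p0 q0 by blast
  then obtain k1 k2 where k: "(q - q0) - (p - p0) = of_int k1 *\<^sub>R v1 + of_int k2 *\<^sub>R v2"
    by (auto simp: lattice_iff)
  have "lattice_diff v1 v2 p0 q0 k1 k2 = q - p"
    using k by (simp add: lattice_diff_def algebra_simps)
  then have "norm (lattice_diff v1 v2 p0 q0 k1 k2) = 1"
    using assms(3) by (simp add: dist_norm norm_minus_commute)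
  then have 1: "torus_dist v1 v2 p0 q0 = 1"
    using per p0(1) q0(1) unfolding perfectly_periodic_def by blast
  have "p0 - q0 = (p - q) + ((q - q0) - (p - p0))" by simp
  then have "infdist (p0 - q0) ?L = infdist (p - q) ?L"
    using infdist_lattice_shift[OF d] by (rule ssubst)
  then show ?thesis
    using 1 by (simp only: torus_dist_eq_infdist)
qed

text \<open>
The closed interval of edge lengths absorbs exactly the error \<open>2 r\<close> made by replacing two points with
the centres of their discs.
\<close>

lemma one_avoiding_periodic_thickening:
  assumes span: "range (\<lambda>(s, t). s *\<^sub>R v1 + t *\<^sub>R v2) = UNIV"
    and per: "perfectly_periodic v1 v2" and r: "2 * r < 1"
    and ind: "independent_set (grid_vertices v1 v2 n m) (grid_edges v1 v2 r n m) M"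
  shows "one_avoiding (periodic_thickening v1 v2 r M)"
  unfolding one_avoiding_def
proof (intro ballI notI)
  let ?L = "integer_lattice v1 v2"
  fix p q
  assume "p \<in> periodic_thickening v1 v2 r M" "q \<in> periodic_thickening v1 v2 r M"
  then obtain x k y l where x: "x \<in> M" "k \<in> ?L" "dist (x + k) p \<le> r"
    and y: "y \<in> M" "l \<in> ?L" "dist (y + l) q \<le> r"
    by (auto simp: periodic_thickening_def)
  assume "dist p q = 1"
  then have pq: "infdist (p - q) ?L = 1"
    using torus_dist_eq_1 span per by blast
  have "dist ((x + k) - (y + l)) (p - q) \<le> 2 * r"
    using x(3) y(3) dist_triangle_add[of "x + k" "- (y + l)" p "- q"]
    by (simp add: dist_norm norm_minus_commute algebra_simps)
  then have "\<bar>infdist ((x + k) - (y + l)) ?L - 1\<bar> \<le> 2 * r"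
    using infdist_triangle[of "(x + k) - (y + l)" ?L "p - q"]
      infdist_triangle[of "p - q" ?L "(x + k) - (y + l)"] pq
    by (simp add: dist_commute)
  moreover have "infdist ((x + k) - (y + l)) ?L = infdist (x - y) ?L"
    using infdist_lattice_shift[OF lattice_diff_closed[OF x(2) y(2)], of "x - y"]
    by (simp add: algebra_simps)
  ultimately have xy: "torus_dist v1 v2 x y \<in> {1 - 2 * r..1 + 2 * r}"
    by (auto simp: torus_dist_eq_infdist)
  show False
  proof (cases "x = y")
    case True
    then have "torus_dist v1 v2 x y = 0"
      by (simp add: torus_dist_eq_infdist zero_in_lattice)
    then show False using xy r by simp
  next
    case False
    then show False
      using ind xy x(1) y(1) unfolding independent_set_def grid_edges_def by blast
  qed
qed

section \<open>Covering the plane by discs around lattice points\<close>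

text \<open>
Here \<open>z\<close> is the circumcenter of the triangle with vertices \<open>0, u1, u2\<close>: the two hypotheses on it say that
it is equidistant from \<open>0\<close> and \<open>u1\<close> and from \<open>0\<close> and \<open>u2\<close>, and \<open>norm z\<close> is the circumradius. The squared
distances from \<open>w\<close> to the vertices, averaged with the barycentric weights of \<open>w\<close>, give
\<open>(norm z)\<^sup>2 - (norm (w - z))\<^sup>2\<close>, so one of them is at most \<open>(norm z)\<^sup>2\<close>. The argument covers obtuse
triangles as well.
\<close>

lemma triangle_within_circumradius:
  fixes u1 u2 w z :: "'a::real_inner"
  assumes w: "w = s *\<^sub>R u1 + t *\<^sub>R u2" and st: "s \<ge> 0" "t \<ge> 0" "s + t \<le> 1"
    and z: "z \<bullet> u1 = (norm u1)\<^sup>2 / 2" "z \<bullet> u2 = (norm u2)\<^sup>2 / 2"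
  shows "\<exists>x\<in>{0, u1, u2}. dist w x \<le> norm z"
proof (rule ccontr)
  assume "\<not> ?thesis"
  then have far: "norm z < norm w" "norm z < norm (w - u1)" "norm z < norm (w - u2)"
    by (simp_all add: dist_norm not_le)
  have sq: "(norm z)\<^sup>2 < (norm w)\<^sup>2" "(norm z)\<^sup>2 < (norm (w - u1))\<^sup>2" "(norm z)\<^sup>2 < (norm (w - u2))\<^sup>2"
    by (simp_all add: far power_strict_mono)
  \<comment> \<open>the weighted mean of the squared vertex distances of \<open>w\<close>, minus the squared circumradius\<close>
  define e where "e = (1 - s - t) * ((norm w)\<^sup>2 - (norm z)\<^sup>2) + s * ((norm (w - u1))\<^sup>2 - (norm z)\<^sup>2)
    + t * ((norm (w - u2))\<^sup>2 - (norm z)\<^sup>2)"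
  have "e = - (norm (w - z))\<^sup>2"
  proof -
    have 1: "e = w \<bullet> w - 2 * (s * (u1 \<bullet> w) + t * (u2 \<bullet> w)) + s * (u1 \<bullet> u1) + t * (u2 \<bullet> u2) - z \<bullet> z"
      unfolding e_def power2_norm_eq_inner by (simp add: algebra_simps inner_commute)
    have 2: "s * (u1 \<bullet> w) + t * (u2 \<bullet> w) = w \<bullet> w"
      by (subst (3) w) (simp add: inner_add_left)
    have 3: "s * (u1 \<bullet> u1) + t * (u2 \<bullet> u2) = 2 * (z \<bullet> w)"
    proof -
      have "u1 \<bullet> u1 = 2 * (z \<bullet> u1)" "u2 \<bullet> u2 = 2 * (z \<bullet> u2)"
        using z by (simp_all add: power2_norm_eq_inner)
      then show ?thesis by (simp add: w inner_add_right algebra_simps)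
    qed
    show ?thesis
      using 1 2 3 unfolding power2_norm_eq_inner by (simp add: algebra_simps inner_commute)
  qed
  moreover have "e > 0"
  proof -
    have nn: "(1 - s - t) * ((norm w)\<^sup>2 - (norm z)\<^sup>2) \<ge> 0" "s * ((norm (w - u1))\<^sup>2 - (norm z)\<^sup>2) \<ge> 0"
      "t * ((norm (w - u2))\<^sup>2 - (norm z)\<^sup>2) \<ge> 0"
      by (rule mult_nonneg_nonneg; use st sq in linarith)+
    \<comment> \<open>the weights sum to 1, so one of them is positive and makes the mean strictly positive\<close>
    consider "1 - s - t > 0" | "s > 0" | "t > 0" using st by linarith
    then show ?thesis
    proof cases
      case 1
      then have "(1 - s - t) * ((norm w)\<^sup>2 - (norm z)\<^sup>2) > 0"
        using sq by (intro mult_pos_pos) linarith+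
      then show ?thesis using nn by (simp add: e_def)
    next
      case 2
      then have "s * ((norm (w - u1))\<^sup>2 - (norm z)\<^sup>2) > 0"
        using sq by (intro mult_pos_pos) linarith+
      then show ?thesis using nn by (simp add: e_def)
    next
      case 3
      then have "t * ((norm (w - u2))\<^sup>2 - (norm z)\<^sup>2) > 0"
        using sq by (intro mult_pos_pos) linarith+
      then show ?thesis using nn by (simp add: e_def)
    qed
  qed
  ultimately show False using zero_le_power2[of "norm (w - z)"] by linarith
qed

text \<open>
The diagonal from \<open>u1\<close> to \<open>u2\<close> cuts the fundamental parallelogram into two triangles, which the point
reflection \<open>x \<mapsto> u1 + u2 - x\<close> exchanges. Since it preserves the lattice, the triangle with vertices
\<open>0, u1, u2\<close> suffices.
\<close>

lemma lattice_covering_radius: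
  fixes u1 u2 z :: "real ^ 2"
  assumes z: "z \<bullet> u1 = (norm u1)\<^sup>2 / 2" "z \<bullet> u2 = (norm u2)\<^sup>2 / 2"
    and span: "range (\<lambda>(s, t). s *\<^sub>R u1 + t *\<^sub>R u2) = UNIV"
  obtains x where "x \<in> integer_lattice u1 u2" "dist p x \<le> norm z"
proof -
  obtain p0 where p0: "p0 \<in> flat_torus u1 u2" "p - p0 \<in> integer_lattice u1 u2"
    using flat_torus_representative span by (metis UNIV_I)
  obtain s t where st: "p0 = s *\<^sub>R u1 + t *\<^sub>R u2" "0 \<le> s" "s < 1" "0 \<le> t" "t < 1"
    using p0(1) by (auto simp: flat_torus_def)
  have u: "0 \<in> integer_lattice u1 u2" "u1 \<in> integer_lattice u1 u2" "u2 \<in> integer_lattice u1 u2"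
    using latticeI[of 0 u1 0 u2] latticeI[of 1 u1 0 u2] latticeI[of 0 u1 1 u2] by simp_all
  have "\<exists>x \<in> integer_lattice u1 u2. dist p0 x \<le> norm z"
  proof (cases "s + t \<le> 1")
    case True
    then show ?thesis
      using triangle_within_circumradius[OF st(1,2,4) True z] u by blast
  next
    case False
    have w: "(u1 + u2) - p0 = (1 - s) *\<^sub>R u1 + (1 - t) *\<^sub>R u2"
      by (simp add: st algebra_simps)
    have "0 \<le> 1 - s" "0 \<le> 1 - t" "(1 - s) + (1 - t) \<le> 1"
      using st False by simp_all
    from triangle_within_circumradius[OF w this z]
    obtain x where x: "x \<in> {0, u1, u2}" "dist ((u1 + u2) - p0) x \<le> norm z" by blast
    have "(u1 + u2) - x \<in> integer_lattice u1 u2"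
      using x(1) u by (blast intro: lattice_add lattice_diff_closed)
    moreover have "dist p0 ((u1 + u2) - x) = dist ((u1 + u2) - p0) x"
      by (simp add: dist_norm norm_minus_commute algebra_simps)
    ultimately show ?thesis using x(2) by metis
  qed
  then obtain x where x: "x \<in> integer_lattice u1 u2" "dist p0 x \<le> norm z" by blast
  show thesis
  proof
    show "x + (p - p0) \<in> integer_lattice u1 u2" using lattice_add x p0 by blast
    show "dist p (x + (p - p0)) \<le> norm z"
      using x(2) by (simp add: dist_norm algebra_simps)
  qed
qed

text \<open>
By the law of cosines the square root is the length of the side opposite to the angle \<open>\<alpha>\<close>, so
\<open>norm z\<close> comes out as the circumradius given by the law of sines. The coefficients of \<open>z\<close> with respect to
\<open>u1\<close> and \<open>u2\<close> solve the two bisector equations by Cramer's rule; their determinant is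
\<open>(a b sin \<alpha>)\<^sup>2\<close>.
\<close>

lemma exists_circumcenter:
  fixes u1 u2 :: "'a::real_inner"
  assumes \<alpha>: "sin \<alpha> > 0" and pos: "norm u1 = a" "norm u2 = b" "a > 0" "b > 0"
    and inner: "u1 \<bullet> u2 = a * b * cos \<alpha>"
  obtains z where "z \<bullet> u1 = (norm u1)\<^sup>2 / 2" "z \<bullet> u2 = (norm u2)\<^sup>2 / 2"
    "norm z = sqrt (a\<^sup>2 + b\<^sup>2 - 2 * a * b * cos \<alpha>) / (2 * sin \<alpha>)"
proof -
  define S where "S = sin \<alpha>"
  define C where "C = cos \<alpha>"
  have S: "S > 0" "S\<^sup>2 = 1 - C\<^sup>2"
    using \<alpha> by (auto simp: S_def C_def sin_squared_eq)
  define x where "x = (a - b * C) / (2 * a * S\<^sup>2)"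
  define y where "y = (b - a * C) / (2 * b * S\<^sup>2)"
  define z where "z = x *\<^sub>R u1 + y *\<^sub>R u2"
  have u: "u1 \<bullet> u1 = a\<^sup>2" "u2 \<bullet> u2 = b\<^sup>2" "u1 \<bullet> u2 = a * b * C" "u2 \<bullet> u1 = a * b * C"
    using pos inner by (auto simp: dot_square_norm C_def inner_commute)
  have z1: "z \<bullet> u1 = a\<^sup>2 / 2"
  proof -
    have "z \<bullet> u1 = (a * (a - b * C) + a * C * (b - a * C)) / (2 * S\<^sup>2)"
      using S(1) pos by (simp add: z_def inner_add_left u x_def y_def field_simps power2_eq_square)
    also have "a * (a - b * C) + a * C * (b - a * C) = a\<^sup>2 * S\<^sup>2"
      unfolding S(2) by (simp add: algebra_simps power2_eq_square)
    finally show ?thesis using S(1) by simp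
  qed
  have z2: "z \<bullet> u2 = b\<^sup>2 / 2"
  proof -
    have "z \<bullet> u2 = (b * C * (a - b * C) + b * (b - a * C)) / (2 * S\<^sup>2)"
      using S(1) pos by (simp add: z_def inner_add_left u x_def y_def field_simps power2_eq_square)
    also have "b * C * (a - b * C) + b * (b - a * C) = b\<^sup>2 * S\<^sup>2"
      unfolding S(2) by (simp add: algebra_simps power2_eq_square)
    finally show ?thesis using S(1) by simp
  qed
  have "z \<bullet> z = x * (z \<bullet> u1) + y * (z \<bullet> u2)"
    by (subst (2) z_def) (simp add: inner_add_right)
  also have "\<dots> = (a\<^sup>2 + b\<^sup>2 - 2 * a * b * C) / (2 * S)\<^sup>2"
    using S(1) pos by (simp add: z1 z2 x_def y_def field_simps power2_eq_square)
  finally have "norm z = sqrt ((a\<^sup>2 + b\<^sup>2 - 2 * a * b * C) / (2 * S)\<^sup>2)"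
    by (simp add: norm_eq_sqrt_inner)
  also have "\<dots> = sqrt (a\<^sup>2 + b\<^sup>2 - 2 * a * b * C) / (2 * S)"
    using S(1) by (simp add: real_sqrt_divide real_sqrt_mult)
  finally show thesis
    using that[of z] z1 z2 pos by (simp add: S_def C_def)
qed

lemma cramer_plane:
  fixes v1 v2 :: "real ^ 2"
  assumes "v1 $ 1 * v2 $ 2 - v1 $ 2 * v2 $ 1 \<noteq> 0"
  shows "range (\<lambda>(s, t). s *\<^sub>R v1 + t *\<^sub>R v2) = UNIV"
    and "s *\<^sub>R v1 + t *\<^sub>R v2 = s' *\<^sub>R v1 + t' *\<^sub>R v2 \<Longrightarrow> s = s' \<and> t = t'"
proof -
  let ?d = "v1 $ 1 * v2 $ 2 - v1 $ 2 * v2 $ 1"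
  have "p \<in> range (\<lambda>(s, t). s *\<^sub>R v1 + t *\<^sub>R v2)" for p :: "real ^ 2"
  proof -
    have "p = ((p $ 1 * v2 $ 2 - p $ 2 * v2 $ 1) / ?d) *\<^sub>R v1
      + ((v1 $ 1 * p $ 2 - v1 $ 2 * p $ 1) / ?d) *\<^sub>R v2"
    proof -
      have "?d * p $ 1 = (p $ 1 * v2 $ 2 - p $ 2 * v2 $ 1) * v1 $ 1 + (v1 $ 1 * p $ 2 - v1 $ 2 * p $ 1) * v2 $ 1"
        "?d * p $ 2 = (p $ 1 * v2 $ 2 - p $ 2 * v2 $ 1) * v1 $ 2 + (v1 $ 1 * p $ 2 - v1 $ 2 * p $ 1) * v2 $ 2"
        by (simp_all add: algebra_simps)
      then show ?thesis
        using assms by (simp add: vec_eq_iff forall_2 add_divide_distrib[symmetric] eq_divide_eq mult.commute)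
    qed
    then show ?thesis by (metis (mono_tags, lifting) case_prod_conv rangeI)
  qed
  then show "range (\<lambda>(s, t). s *\<^sub>R v1 + t *\<^sub>R v2) = UNIV" by blast
  assume "s *\<^sub>R v1 + t *\<^sub>R v2 = s' *\<^sub>R v1 + t' *\<^sub>R v2"
  then have e: "(s - s') * v1 $ 1 + (t - t') * v2 $ 1 = 0" "(s - s') * v1 $ 2 + (t - t') * v2 $ 2 = 0"
    by (simp_all add: vec_eq_iff forall_2 algebra_simps)
  have "(s - s') * ?d = ((s - s') * v1 $ 1 + (t - t') * v2 $ 1) * v2 $ 2
      - ((s - s') * v1 $ 2 + (t - t') * v2 $ 2) * v2 $ 1"
    "(t - t') * ?d = ((s - s') * v1 $ 2 + (t - t') * v2 $ 2) * v1 $ 1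
      - ((s - s') * v1 $ 1 + (t - t') * v2 $ 1) * v1 $ 2"
    by (simp_all add: algebra_simps)
  then have "(s - s') * ?d = 0" "(t - t') * ?d = 0"
    unfolding e by simp_all
  then show "s = s' \<and> t = t'" using assms by simp
qed

section \<open>Density by averaging over translates\<close>

text \<open>
Double counting: integrating the covering multiplicity over \<open>ball 0 R\<close> sums the areas of the translates
inside that disc, and the translate by \<open>g\<close> occupies as much of it as \<open>A\<close> occupies of the disc around
\<open>- g\<close>, which is contained in \<open>ball 0 (R + K)\<close>.
\<close>

lemma sum_measure_translates_ge:
  fixes A :: "(real ^ 2) set"
  assumes A: "A \<in> sets lebesgue" and G: "finite G"
    and cover: "\<And>p. N \<le> card {g \<in> G. p - g \<in> A}"
    and K: "\<And>g. g \<in> G \<Longrightarrow> norm g \<le> K"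
  shows "real N * measure lebesgue (ball (0 :: real ^ 2) R)
    \<le> real (card G) * measure lebesgue (A \<inter> ball 0 (R + K))"
proof -
  define S where "S g = (+) g ` (A \<inter> ball (- g) R)" for g
  have AB: "A \<inter> ball x R' \<in> lmeasurable" for x R'
    using fmeasurable_Int_fmeasurable[OF lmeasurable_ball A, of x R'] by (simp add: Int_commute)
  have S: "S g \<in> lmeasurable" for g
    unfolding S_def using AB by (rule measurable_translation)
  have S_iff: "p \<in> S g \<longleftrightarrow> p \<in> ball 0 R \<and> p - g \<in> A" for p g
  proof -
    have "p \<in> S g \<longleftrightarrow> p - g \<in> A \<inter> ball (- g) R"
      unfolding S_def by (auto simp: image_iff intro!: bexI[of _ "p - g"])
    also have "\<dots> \<longleftrightarrow> p \<in> ball 0 R \<and> p - g \<in> A"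
      by (auto simp: dist_norm norm_minus_commute)
    finally show ?thesis .
  qed
  have int: "integrable lebesgue (indicator (S g) :: _ \<Rightarrow> real)" for g
    using S by (simp only: lmeasurable_iff_integrable)
  have "real N * measure lebesgue (ball (0 :: real ^ 2) R)
      = (\<integral>p. real N * indicator (ball 0 R) p \<partial>(lebesgue :: (real ^ 2) measure))"
    by simp
  also have "\<dots> \<le> (\<integral>p. (\<Sum>g\<in>G. indicator (S g) p) \<partial>lebesgue)"
  proof (rule integral_mono)
    show "integrable lebesgue (\<lambda>p::real ^ 2. real N * indicator (ball 0 R) p)"
      using lmeasurable_ball[of "0::real^2" R]
      by (intro integrable_mult_right) (simp only: lmeasurable_iff_integrable)
    show "integrable lebesgue (\<lambda>p. \<Sum>g\<in>G. indicator (S g) p :: real)"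
      using int by simp
    fix p :: "real ^ 2"
    show "real N * indicator (ball 0 R) p \<le> (\<Sum>g\<in>G. indicator (S g) p)"
    proof (cases "p \<in> ball 0 R")
      case True
      then have "(\<Sum>g\<in>G. indicator (S g) p :: real) = (\<Sum>g\<in>G. if p - g \<in> A then 1 else 0)"
        by (intro sum.cong) (auto simp: S_iff indicator_def)
      also have "\<dots> = real (card {g \<in> G. p - g \<in> A})"
        using G by (simp add: sum.If_cases Int_def)
      finally show ?thesis using True cover[of p] by simp
    qed (simp add: sum_nonneg)
  qed
  also have "\<dots> = (\<Sum>g\<in>G. measure lebesgue (S g))"
    using int by (subst Bochner_Integration.integral_sum) auto
  also have "\<dots> \<le> (\<Sum>g\<in>G. measure lebesgue (A \<inter> ball 0 (R + K)))"
  proof (rule sum_mono)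
    fix g assume "g \<in> G"
    have "A \<inter> ball (- g) R \<subseteq> A \<inter> ball 0 (R + K)"
    proof safe
      fix p assume "p \<in> ball (- g) R"
      then have "norm (p + g) < R" by (simp add: dist_norm norm_minus_commute add.commute)
      then show "p \<in> ball 0 (R + K)"
        using K[OF \<open>g \<in> G\<close>] norm_triangle_ineq4[of "p + g" g] by simp
    qed
    then have "measure lebesgue (A \<inter> ball (- g) R) \<le> measure lebesgue (A \<inter> ball 0 (R + K))"
      using AB by (intro measure_mono_fmeasurable) auto
    then show "measure lebesgue (S g) \<le> measure lebesgue (A \<inter> ball 0 (R + K))"
      by (simp add: S_def measure_translation)
  qed
  finally show ?thesis by simp
qed

text \<open>
The enlargement of the disc by the fixed length \<open>K\<close> costs a factor \<open>((R - K) / R)\<^sup>2\<close>, which tends to 1.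
\<close>

lemma upper_density_ge_by_averaging:
  fixes A :: "(real ^ 2) set"
  assumes A: "A \<in> sets lebesgue" and G: "finite G" "G \<noteq> {}"
    and cover: "\<And>p. N \<le> card {g \<in> G. p - g \<in> A}"
  shows "upper_density 0 A \<ge> ereal (real N / real (card G))"
proof -
  define K where "K = (\<Sum>g\<in>G. norm g)"
  have K: "norm g \<le> K" if "g \<in> G" for g
    unfolding K_def using G(1) that by (intro member_le_sum) auto
  have K0: "K \<ge> 0" unfolding K_def by (simp add: sum_nonneg)
  have cG: "card G > 0" using G by (simp add: card_gt_0_iff)
  let ?f = "\<lambda>R. measure lebesgue (A \<inter> ball 0 R) / measure lebesgue (ball (0::real^2) R)"
  let ?h = "\<lambda>R. real N / real (card G) * ((R - K) / R)\<^sup>2"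
  have le: "?h R \<le> ?f R" if "R > K" for R
  proof -
    define V where "V = unit_ball_vol 2"
    have V: "V > 0" unfolding V_def by simp
    have vol: "measure lebesgue (ball (0::real^2) R') = V * R'\<^sup>2" if "R' \<ge> 0" for R'
      using content_ball[OF that, of "0::real^2"] by (simp add: V_def)
    have "real N * (V * (R - K)\<^sup>2) \<le> real (card G) * measure lebesgue (A \<inter> ball 0 R)"
      using sum_measure_translates_ge[OF A G(1) cover K, of "R - K"] that vol[of "R - K"] by simp
    then show ?thesis
      using that K0 V cG vol[of R] by (simp add: field_simps)
  qed
  have "((\<lambda>R. (R - K) / R) \<longlongrightarrow> 1) at_top"
  proof -
    have "((\<lambda>R. 1 - K / R) \<longlongrightarrow> 1 - 0) at_top"
      by (intro tendsto_intros real_tendsto_divide_at_top[OF tendsto_const filterlim_ident])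
    moreover have "\<forall>\<^sub>F R in at_top. 1 - K / R = (R - K) / R"
      using eventually_gt_at_top[of 0] by eventually_elim (simp add: field_simps)
    ultimately show ?thesis by (simp add: tendsto_cong)
  qed
  then have "(?h \<longlongrightarrow> real N / real (card G) * 1\<^sup>2) at_top"
    by (intro tendsto_intros)
  then have lim: "((\<lambda>R. ereal (?h R)) \<longlongrightarrow> ereal (real N / real (card G))) at_top"
    by simp
  have "ereal (real N / real (card G)) = Limsup at_top (\<lambda>R. ereal (?h R))"
    using lim_imp_Limsup[OF _ lim] by simp
  also have "\<dots> \<le> upper_density 0 A"
    unfolding upper_density_def
    by (intro Limsup_mono eventually_mono[OF eventually_gt_at_top[of K]]) (simp only: ereal_less_eq le)
  finally show ?thesis .
qed

section \<open>Grid points modulo the period lattice\<close>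

text \<open>
The grid contains a representative of every class of the fine lattice modulo the period lattice:
reduce the two integer coordinates modulo \<open>n\<close> and \<open>m\<close>.
\<close>

lemma grid_vertices_representative:
  assumes "n > 0" "m > 0" "x \<in> integer_lattice ((1 / real n) *\<^sub>R v1) ((1 / real m) *\<^sub>R v2)"
  obtains g where "g \<in> grid_vertices v1 v2 n m" "x - g \<in> integer_lattice v1 v2"
proof -
  obtain i j where x: "x = of_int i *\<^sub>R ((1 / real n) *\<^sub>R v1) + of_int j *\<^sub>R ((1 / real m) *\<^sub>R v2)"
    using assms(3) by (auto simp: lattice_iff)
  have quot: "of_int k / real N = real (nat (k mod int N)) / real N + of_int (k div int N)"
    if "N > 0" for k :: int and N :: nat
  proof -
    have "real (nat (k mod int N)) = of_int (k mod int N)" using that by simp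
    moreover have "(of_int k :: real) = of_int (k div int N) * real N + of_int (k mod int N)"
      by (metis div_mult_mod_eq of_int_add of_int_mult of_int_of_nat_eq)
    ultimately show ?thesis using that by (simp add: field_simps)
  qed
  let ?i = "nat (i mod int n)" and ?j = "nat (j mod int m)"
  show thesis
  proof
    have "?i < n" "?j < m" using assms by (simp_all add: nat_less_iff)
    then show "(real ?i / real n) *\<^sub>R v1 + (real ?j / real m) *\<^sub>R v2 \<in> grid_vertices v1 v2 n m"
      unfolding grid_vertices_def by blast
    have "x = (of_int i / real n) *\<^sub>R v1 + (of_int j / real m) *\<^sub>R v2"
      by (simp add: x)
    then have "x - ((real ?i / real n) *\<^sub>R v1 + (real ?j / real m) *\<^sub>R v2)
      = of_int (i div int n) *\<^sub>R v1 + of_int (j div int m) *\<^sub>R v2"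
      unfolding quot[OF assms(1)] quot[OF assms(2)] by (simp add: algebra_simps)
    then show "x - ((real ?i / real n) *\<^sub>R v1 + (real ?j / real m) *\<^sub>R v2) \<in> integer_lattice v1 v2"
      by (simp only: latticeI)
  qed
qed

lemma grid_vertices_subset_lattice:
  "grid_vertices v1 v2 n m \<subseteq> integer_lattice ((1 / real n) *\<^sub>R v1) ((1 / real m) *\<^sub>R v2)"
proof
  fix x assume "x \<in> grid_vertices v1 v2 n m"
  then obtain i j where "x = (real i / real n) *\<^sub>R v1 + (real j / real m) *\<^sub>R v2"
    unfolding grid_vertices_def by blast
  then have "x = of_int (int i) *\<^sub>R ((1 / real n) *\<^sub>R v1) + of_int (int j) *\<^sub>R ((1 / real m) *\<^sub>R v2)"
    by simp
  then show "x \<in> integer_lattice ((1 / real n) *\<^sub>R v1) ((1 / real m) *\<^sub>R v2)"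
    by (simp only: latticeI)
qed

lemma grid_vertices_card:
  "finite (grid_vertices v1 v2 n m)" "card (grid_vertices v1 v2 n m) \<le> n * m"
proof -
  have *: "grid_vertices v1 v2 n m =
    (\<lambda>(i, j). (real i / real n) *\<^sub>R v1 + (real j / real m) *\<^sub>R v2) ` ({..<n} \<times> {..<m})"
    by (auto simp: grid_vertices_def)
  show "finite (grid_vertices v1 v2 n m)" unfolding * by simp
  show "card (grid_vertices v1 v2 n m) \<le> n * m" unfolding * 
    by (rule order_trans[OF card_image_le]) (auto simp: card_cartesian_product)
qed

lemma grid_vertices_subset_flat_torus:
  "grid_vertices v1 v2 n m \<subseteq> flat_torus v1 v2"
proof
  fix x assume "x \<in> grid_vertices v1 v2 n m"
  then obtain i j where "x = (real i / real n) *\<^sub>R v1 + (real j / real m) *\<^sub>R v2" "i < n" "j < m"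
    unfolding grid_vertices_def by blast
  moreover have "real i / real n \<in> {0..<1}" "real j / real m \<in> {0..<1}"
    using \<open>i < n\<close> \<open>j < m\<close> by auto
  ultimately show "x \<in> flat_torus v1 v2" unfolding flat_torus_def by blast
qed

lemma flat_torus_representative_unique:
  assumes det: "v1 $ 1 * v2 $ 2 - v1 $ 2 * v2 $ 1 \<noteq> 0"
    and "x \<in> flat_torus v1 v2" "y \<in> flat_torus v1 v2" "x - y \<in> integer_lattice v1 v2"
  shows "x = y"
proof -
  obtain s t where x: "x = s *\<^sub>R v1 + t *\<^sub>R v2" "0 \<le> s" "s < 1" "0 \<le> t" "t < 1"
    using assms(2) by (auto simp: flat_torus_def)
  obtain s' t' where y: "y = s' *\<^sub>R v1 + t' *\<^sub>R v2" "0 \<le> s'" "s' < 1" "0 \<le> t'" "t' < 1"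
    using assms(3) by (auto simp: flat_torus_def)
  obtain k l where kl: "x - y = of_int k *\<^sub>R v1 + of_int l *\<^sub>R v2"
    using assms(4) by (auto simp: lattice_iff)
  have "(s - s') *\<^sub>R v1 + (t - t') *\<^sub>R v2 = of_int k *\<^sub>R v1 + of_int l *\<^sub>R v2"
    using kl by (simp add: x(1) y(1) algebra_simps)
  then have "s - s' = of_int k" "t - t' = of_int l"
    using cramer_plane(2)[OF det] by blast+
  moreover from this have "k = 0" "l = 0" using x y by linarith+
  ultimately show ?thesis using x y by simp
qed

text \<open>
Each \<open>x \<in> M\<close> is sent to the grid point \<open>g x\<close> congruent to \<open>z - x\<close>, so that \<open>z - g x\<close> lies in \<open>x\<close> plus the
period lattice and \<open>p - g x\<close> in the disc around it. Two vertices with the same image are congruent,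
and distinct points of the fundamental parallelogram are not.
\<close>

lemma card_translates_ge:
  assumes det: "v1 $ 1 * v2 $ 2 - v1 $ 2 * v2 $ 1 \<noteq> 0"
    and nm: "n > 0" "m > 0" and M: "M \<subseteq> grid_vertices v1 v2 n m"
    and near: "z \<in> integer_lattice ((1 / real n) *\<^sub>R v1) ((1 / real m) *\<^sub>R v2)" "dist p z \<le> r"
  shows "card M \<le> card {g \<in> grid_vertices v1 v2 n m. p - g \<in> periodic_thickening v1 v2 r M}"
proof -
  let ?G = "grid_vertices v1 v2 n m" and ?L = "integer_lattice v1 v2"
  have "\<exists>g. g \<in> ?G \<and> z - x - g \<in> ?L" if "x \<in> M" for x
  proof -
    have "z - x \<in> integer_lattice ((1 / real n) *\<^sub>R v1) ((1 / real m) *\<^sub>R v2)"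
      using near(1) that M grid_vertices_subset_lattice lattice_diff_closed by blast
    then show ?thesis using grid_vertices_representative[OF nm] by metis
  qed
  then obtain g where g: "\<And>x. x \<in> M \<Longrightarrow> g x \<in> ?G" "\<And>x. x \<in> M \<Longrightarrow> z - x - g x \<in> ?L"
    by metis
  have "inj_on g M"
  proof (rule inj_onI)
    fix x y assume xy: "x \<in> M" "y \<in> M" "g x = g y"
    have "x - y = (z - y - g y) - (z - x - g x)" using xy by simp
    also have "\<dots> \<in> ?L" using g xy lattice_diff_closed by blast
    finally show "x = y"
      using flat_torus_representative_unique[OF det] xy M grid_vertices_subset_flat_torus by blast
  qed
  moreover have "g ` M \<subseteq> {g \<in> ?G. p - g \<in> periodic_thickening v1 v2 r M}"
  proof clarify
    fix x assume x: "x \<in> M"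
    have "dist (x + (z - x - g x)) (p - g x) \<le> r"
      using near(2) by (simp add: dist_norm norm_minus_commute)
    then have "p - g x \<in> periodic_thickening v1 v2 r M"
      unfolding periodic_thickening_def using x g(2)[OF x]
      by (intro UN_I[of x] UN_I[of "z - x - g x"]) (simp_all only: mem_cball)
    then show "g x \<in> ?G \<and> p - g x \<in> periodic_thickening v1 v2 r M" using g(1) x by simp
  qed
  ultimately show ?thesis
    using grid_vertices_card(1) by (intro card_inj_on_le[where f = g]) auto
qed

theorem theorem1:
  fixes v1 v2 :: "real ^ 2" and l1 l2 \<alpha> a b c r :: real and n m :: nat
    and M :: "(real ^ 2) set"
  assumes "l1 > 0" and "l2 > 0" and "0 < \<alpha>" and "\<alpha> \<le> pi / 2"
    and "norm v1 = l1" and "norm v2 = l2" and "vec_angle v1 v2 = \<alpha>"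
    and "perfectly_periodic v1 v2"
    and "n > 0" and "m > 0"
    and "a = l1 / real n" and "b = l2 / real m"
    and "c = sqrt (a\<^sup>2 + b\<^sup>2 - 2 * a * b * cos \<alpha>)"
    and "r = c / (2 * sin \<alpha>)"
    and "2 * r < 1"
    and "independent_set (grid_vertices v1 v2 n m) (grid_edges v1 v2 r n m) M"
  shows "m1_plane \<ge> ereal (real (card M) / (real n * real m))"
proof -
  let ?G = "grid_vertices v1 v2 n m"
  let ?A = "periodic_thickening v1 v2 r M"
  define u1 where "u1 = (1 / real n) *\<^sub>R v1"
  define u2 where "u2 = (1 / real m) *\<^sub>R v2"
  have sin: "sin \<alpha> > 0"
    using assms(3,4) by (intro sin_gt_zero) auto
  have inner: "v1 \<bullet> v2 = l1 * l2 * cos \<alpha>"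
  proof -
    have "\<bar>v1 \<bullet> v2 / (l1 * l2)\<bar> \<le> 1"
      using Cauchy_Schwarz_ineq2[of v1 v2] assms(1,2,5,6) by (simp add: abs_mult)
    then have "cos \<alpha> = v1 \<bullet> v2 / (l1 * l2)"
      using assms(5,6,7) unfolding vec_angle_def by (metis cos_arccos_abs)
    then show ?thesis using assms(1,2) by simp
  qed
  have det: "v1 $ 1 * v2 $ 2 - v1 $ 2 * v2 $ 1 \<noteq> 0"
  proof -
    \<comment> \<open>the squared area of the fundamental parallelogram is the Gram determinant\<close>
    have "(v1 $ 1 * v2 $ 2 - v1 $ 2 * v2 $ 1)\<^sup>2 = (v1 \<bullet> v1) * (v2 \<bullet> v2) - (v1 \<bullet> v2)\<^sup>2"
      by (simp add: inner_vec_def sum_2 power2_eq_square algebra_simps)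
    also have "\<dots> = (l1 * l2 * sin \<alpha>)\<^sup>2"
      by (simp add: inner dot_square_norm assms(5,6) power_mult_distrib sin_squared_eq algebra_simps)
    finally show ?thesis using assms(1,2) sin by auto
  qed
  have span: "range (\<lambda>(s, t). s *\<^sub>R v1 + t *\<^sub>R v2) = UNIV"
    using cramer_plane(1)[OF det] .
  have span': "range (\<lambda>(s, t). s *\<^sub>R u1 + t *\<^sub>R u2) = UNIV"
  proof (rule cramer_plane(1))
    have "u1 $ 1 * u2 $ 2 - u1 $ 2 * u2 $ 1 = (v1 $ 1 * v2 $ 2 - v1 $ 2 * v2 $ 1) / (real n * real m)"
      by (simp add: u1_def u2_def diff_divide_distrib)
    then show "u1 $ 1 * u2 $ 2 - u1 $ 2 * u2 $ 1 \<noteq> 0" using det assms(9,10) by simp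
  qed
  have "norm u1 = a" "norm u2 = b" "a > 0" "b > 0" "u1 \<bullet> u2 = a * b * cos \<alpha>"
    using assms by (simp_all add: u1_def u2_def inner)
  from exists_circumcenter[OF sin this] obtain z
    where z: "z \<bullet> u1 = (norm u1)\<^sup>2 / 2" "z \<bullet> u2 = (norm u2)\<^sup>2 / 2" "norm z = r"
    using assms(13,14) by metis
  have M: "M \<subseteq> ?G"
    using assms(16) by (simp add: independent_set_def)
  have cover: "card M \<le> card {g \<in> ?G. p - g \<in> ?A}" for p
  proof -
    obtain x where "x \<in> integer_lattice u1 u2" "dist p x \<le> r"
      using lattice_covering_radius[OF z(1,2) span'] z(3) by metis
    then show ?thesis
      using card_translates_ge[OF det assms(9,10) M] unfolding u1_def u2_def by blast
  qed
  have "finite M" using M grid_vertices_card(1) finite_subset by blast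
  then have meas: "?A \<in> sets lebesgue"
    using sets_periodic_thickening countable_finite by blast
  have ne: "?G \<noteq> {}"
    using assms(9,10) by (auto simp: grid_vertices_def)
  have "real (card M) / (real n * real m) \<le> real (card M) / real (card ?G)"
  proof (rule divide_left_mono)
    show "real (card ?G) \<le> real n * real m"
      using grid_vertices_card(2)[of v1 v2 n m] by (metis of_nat_le_iff of_nat_mult)
    show "0 < real n * real m * real (card ?G)"
      using assms(9,10) ne grid_vertices_card(1) by (simp add: card_gt_0_iff)
  qed simp
  then have "ereal (real (card M) / (real n * real m)) \<le> ereal (real (card M) / real (card ?G))"
    by simp
  also have "\<dots> \<le> upper_density 0 ?A"
    using upper_density_ge_by_averaging[OF meas grid_vertices_card(1) ne cover] .
  also have "\<dots> \<le> m1_plane"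
    unfolding m1_plane_def
    using meas one_avoiding_periodic_thickening[OF span assms(8,15,16)] by (intro SUP_upper) simp
  finally show ?thesis .
qed

end
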